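(* Let $t$ be even. Given two sets $A,B$ of $N$ tensors in $\{0,1\}^{2\times\cdots\times2}$ ($t$ factors) such that every tensor in $B$ is max-invariant, there is a deterministic algorithm running in $O(N\,\mathrm{poly}(2^t))$ time that outputs a set $A'$ of $N$ regular expressions of length $\mathrm{poly}(2^t)$ and a set $B'$ of $N$ strings of length $2^t$, all over the alphabet $\{0,1,\bot\}$, together with a correspondence $a\mapsto a'\in A'$, $b\mapsto b'\in B'$, such that $\mathrm{MaxSim}(a',b')=s(a,b)$ for all $a\in A$, $b\in B$.
   Context: Tensors indexed by $i=(i_1,\dots,i_t)\in\{0,1\}^t$; tropical similarity $s(u,v)=\mathbb{E}_{i_1}\max_{i_2}\mathbb{E}_{i_3}\cdots\max_{i_t}(u_i\cdot v_i)$, $\mathbb{E}$ the average over $\{0,1\}$. A tensor $x$ is max-invariant if $x_{i}$ does not depend on $i_2,i_4,\dots,i_t$. Regular expressions over an alphabet $\Sigma$ are built from symbols by concatenation, alternation $[R\mid S]$, $[R]^+$ and $[R]^*$, with the usual language $L(\cdot)$. For equal-length strings $x,y$ of length $m$, $\mathrm{HamSim}(x,y)=\frac1m\#\{j:x_j=y_j\}$; for a regular expression $a$ and string $b$, $\mathrm{MaxSim}(a,b)=\max\{\mathrm{HamSim}(x,b):x\in L(a),|x|=|b|\}$. *)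

theory Defs
  imports Complex_Main "HOL-Library.FuncSet"
begin

definition indices :: "nat \<Rightarrow> nat list set" where
  "indices t = {i. length i = t \<and> set i \<subseteq> {0, 1}}"

text \<open>Extensional functions, so that distinct members really are distinct tensors.\<close>

definition tensors :: "nat \<Rightarrow> (nat list \<Rightarrow> nat) set" where
  "tensors t = indices t \<rightarrow>\<^sub>E {0, 1}"

text \<open>\<open>avg_level t w\<close> is the alternating expression in \<open>t\<close> index coordinates that starts
  with an average, \<open>max_level t w\<close> the one that starts with a maximum.\<close>

fun avg_level :: "nat \<Rightarrow> (nat list \<Rightarrow> real) \<Rightarrow> real"
  and max_level :: "nat \<Rightarrow> (nat list \<Rightarrow> real) \<Rightarrow> real" where
  "avg_level 0 w = w []"
| "avg_level (Suc n) w = (max_level n (\<lambda>i. w (0 # i)) + max_level n (\<lambda>i. w (1 # i))) / 2"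
| "max_level 0 w = w []"
| "max_level (Suc n) w = max (avg_level n (\<lambda>i. w (0 # i))) (avg_level n (\<lambda>i. w (1 # i)))"

definition trop_sim :: "nat \<Rightarrow> (nat list \<Rightarrow> nat) \<Rightarrow> (nat list \<Rightarrow> nat) \<Rightarrow> real" where
  "trop_sim t u v = avg_level t (\<lambda>i. real (u i * v i))"

text \<open>List positions count from 0, so the coordinates \<open>i\<^sub>1, i\<^sub>3, \<dots>\<close> sit at the even positions.\<close>

definition max_invariant :: "nat \<Rightarrow> (nat list \<Rightarrow> nat) \<Rightarrow> bool" where
  "max_invariant t x \<longleftrightarrow>
     (\<forall>i \<in> indices t. \<forall>j \<in> indices t. (\<forall>k < t. even k \<longrightarrow> i ! k = j ! k) \<longrightarrow> x i = x j)"

datatype letter = L0 | L1 | LBot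

datatype 'a regex =
    Sym 'a
  | Cat "'a regex" "'a regex"
  | Alt "'a regex" "'a regex"
  | Plus "'a regex"
  | Star "'a regex"

fun lang :: "'a regex \<Rightarrow> 'a list set" where
  "lang (Sym c) = {[c]}"
| "lang (Cat r s) = {x @ y | x y. x \<in> lang r \<and> y \<in> lang s}"
| "lang (Alt r s) = lang r \<union> lang s"
| "lang (Plus r) = {concat xs | xs. xs \<noteq> [] \<and> set xs \<subseteq> lang r}"
| "lang (Star r) = {concat xs | xs. set xs \<subseteq> lang r}"

definition HamSim :: "'a list \<Rightarrow> 'a list \<Rightarrow> real" where
  "HamSim x y = real (card {j. j < length x \<and> x ! j = y ! j}) / real (length x)"

text \<open>Meaningful only if \<open>lang a\<close> contains a word of length \<open>length b\<close>.\<close>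

definition MaxSim :: "'a regex \<Rightarrow> 'a list \<Rightarrow> real" where
  "MaxSim a b = Max {HamSim x b | x. x \<in> lang a \<and> length x = length b}"

text \<open>\<open>ItemEnd\<close> terminates every item of a list and \<open>ListEnd\<close> separates the two lists that
  form an input or an output.\<close>

datatype token = Letter letter | LBrack | Bar | RBrack | PlusSign | StarSign | ItemEnd | ListEnd

text \<open>The written form of an expression: concatenation is juxtaposition, hence the text
  determines the expression up to associativity of concatenation.\<close>

fun regex_text :: "letter regex \<Rightarrow> token list" where
  "regex_text (Sym c) = [Letter c]"
| "regex_text (Cat r s) = regex_text r @ regex_text s"
| "regex_text (Alt r s) = [LBrack] @ regex_text r @ [Bar] @ regex_text s @ [RBrack]"
| "regex_text (Plus r) = [LBrack] @ regex_text r @ [RBrack, PlusSign]"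
| "regex_text (Star r) = [LBrack] @ regex_text r @ [RBrack, StarSign]"

definition regex_length :: "letter regex \<Rightarrow> nat" where
  "regex_length r = length (regex_text r)"

text \<open>The indices of \<open>indices t\<close> in lexicographic order.\<close>

fun index_list :: "nat \<Rightarrow> nat list list" where
  "index_list 0 = [[]]"
| "index_list (Suc n) = map ((#) 0) (index_list n) @ map ((#) 1) (index_list n)"

definition tensor_text :: "nat \<Rightarrow> (nat list \<Rightarrow> nat) \<Rightarrow> token list" where
  "tensor_text t x = map (\<lambda>i. Letter (if x i = 0 then L0 else L1)) (index_list t)"

definition items_text :: "token list list \<Rightarrow> token list" where
  "items_text ws = concat (map (\<lambda>w. w @ [ItemEnd]) ws)"

definition input_text ::
  "nat \<Rightarrow> (nat list \<Rightarrow> nat) list \<Rightarrow> (nat list \<Rightarrow> nat) list \<Rightarrow> token list" where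
  "input_text t as bs =
     items_text (map (tensor_text t) as) @ [ListEnd] @ items_text (map (tensor_text t) bs)"

definition output_text :: "letter regex list \<Rightarrow> letter list list \<Rightarrow> token list" where
  "output_text rs ws =
     items_text (map regex_text rs) @ [ListEnd] @ items_text (map (map Letter) ws)"

text \<open>States are \<open>0, \<dots>, state_count\<close>, where \<open>0\<close> is initial and \<open>state_count\<close> is the halting
  state. Tape symbols are the numbers below \<open>symbol_count\<close>, with \<open>0\<close> as the blank. Tapes are
  infinite in both directions. Tape \<open>0\<close> carries the input, tape \<open>1\<close> the output.\<close>

datatype move = MoveLeft | NoMove | MoveRight

record turing_machine =
  tape_count :: nat
  state_count :: nat
  symbol_count :: nat
  trans :: "nat \<Rightarrow> nat list \<Rightarrow> nat \<times> (nat \<times> move) list"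

type_synonym tape = "(int \<Rightarrow> nat) \<times> int"

type_synonym config = "nat \<times> tape list"

fun token_code :: "token \<Rightarrow> nat" where
  "token_code (Letter L0) = 1"
| "token_code (Letter L1) = 2"
| "token_code (Letter LBot) = 3"
| "token_code LBrack = 4"
| "token_code Bar = 5"
| "token_code RBrack = 6"
| "token_code PlusSign = 7"
| "token_code StarSign = 8"
| "token_code ItemEnd = 9"
| "token_code ListEnd = 10"

definition wf_machine :: "turing_machine \<Rightarrow> bool" where
  "wf_machine M \<longleftrightarrow>
     2 \<le> tape_count M \<and> range token_code \<subseteq> {0 <..< symbol_count M} \<and>
     (\<forall>q rs. q < state_count M \<and> length rs = tape_count M \<and> set rs \<subseteq> {..< symbol_count M} \<longrightarrow>
        (case trans M q rs of (q', acts) \<Rightarrow>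
           q' \<le> state_count M \<and> length acts = tape_count M \<and>
           fst ` set acts \<subseteq> {..< symbol_count M}))"

fun shift :: "move \<Rightarrow> int" where
  "shift MoveLeft = -1"
| "shift NoMove = 0"
| "shift MoveRight = 1"

fun act :: "nat \<times> move \<Rightarrow> tape \<Rightarrow> tape" where
  "act (w, d) (f, h) = (f(h := w), h + shift d)"

fun step :: "turing_machine \<Rightarrow> config \<Rightarrow> config" where
  "step M (q, ts) =
     (if q < state_count M
      then (case trans M q (map (\<lambda>(f, h). f h) ts) of (q', acts) \<Rightarrow> (q', map2 act acts ts))
      else (q, ts))"

definition cells :: "token list \<Rightarrow> int \<Rightarrow> nat" where
  "cells w j = (if 0 \<le> j \<and> j < int (length w) then token_code (w ! nat j) else 0)"

definition init_config :: "turing_machine \<Rightarrow> token list \<Rightarrow> config" where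
  "init_config M w = (0, (cells w, 0) # replicate (tape_count M - 1) (cells [], 0))"

definition computes_within :: "turing_machine \<Rightarrow> token list \<Rightarrow> token list \<Rightarrow> nat \<Rightarrow> bool" where
  "computes_within M inp out T \<longleftrightarrow>
     (\<exists>n \<le> T. \<exists>ts. (step M ^^ n) (init_config M inp) = (state_count M, ts) \<and>
        fst (ts ! 1) = cells out)"

end

theory Submission
  imports Defs "HOL-Library.More_List"
begin

text \<open>The string of \<open>b\<close> is \<open>b\<close> itself, read in lexicographic order. The expression of \<open>a\<close> mirrors
  the similarity: a leaf is \<open>1\<close> or \<open>\<bottom>\<close>, an average becomes a concatenation, and a maximum over the
  expressions \<open>R\<close>, \<open>S\<close> becomes \<open>[RR|SS]\<close>. The repetition keeps all words at length \<open>2\<^sup>t\<close>, and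
  because \<open>b\<close> is max-invariant both copies face the same half of the string, so the best
  Hamming similarity is exactly the maximum. Two levels multiply the length of the expression
  by about 8 while dividing the number of entries by 4, so its length is about \<open>2\<^sup>t\<close> to the
  power \<open>3/2\<close>.

  A machine with two work tapes builds the expression bottom-up, replacing in each of the \<open>t/2\<close>
  passes every four consecutive expressions by one.\<close>

section \<open>Tapes as zippers\<close>

type_synonym zipper = "nat list \<times> nat list"

definition hd0 :: "nat list \<Rightarrow> nat" where
  "hd0 r = (case r of [] \<Rightarrow> 0 | x # _ \<Rightarrow> x)"

lemma hd0_simps [simp]: "hd0 [] = 0" "hd0 (x # r) = x"
  by (simp_all add: hd0_def)

text \<open>\<open>l\<close> holds the cells left of the head, nearest first, and \<open>r\<close>
  those from the head on, so all moves act at the front of the lists. The default 0 of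
  \<open>nth_default\<close> is the blank.\<close>

fun tape_of :: "int \<Rightarrow> zipper \<Rightarrow> tape" where
  "tape_of h (l, r) =
     (\<lambda>j. if j < h then nth_default 0 l (nat (h - 1 - j)) else nth_default 0 r (nat (j - h)), h)"

declare tape_of.simps [simp del]

fun zact :: "nat \<times> move \<Rightarrow> zipper \<Rightarrow> zipper" where
  "zact (w, MoveLeft) (l, r) = (tl l, hd0 l # w # tl r)"
| "zact (w, NoMove) (l, r) = (l, w # tl r)"
| "zact (w, MoveRight) (l, r) = (w # l, tl r)"

text \<open>Zippers that differ only by blanks at their outer ends describe the same tape.\<close>

definition zeq :: "zipper \<Rightarrow> zipper \<Rightarrow> bool" where
  "zeq z z' \<longleftrightarrow> (\<forall>h. tape_of h z = tape_of h z')"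

lemma nth_default_Cons_nat:
  "0 \<le> j \<Longrightarrow> nth_default d (x # xs) (nat j) = (if j = 0 then x else nth_default d xs (nat (j - 1)))"
  by (cases "nat j") (auto simp: nth_default_Cons nat_diff_distrib')

lemma nth_default_tl: "nth_default d (tl xs) n = nth_default d xs (Suc n)"
  by (cases xs) auto

lemma tape_of_read: "fst (tape_of h z) (snd (tape_of h z)) = hd0 (snd z)"
  by (cases z; cases "snd z") (auto simp: tape_of.simps)

lemma hd0_nth_default: "hd0 r = nth_default 0 r 0"
  by (cases r) auto

lemma act_tape_of: "act (w, d) (tape_of h z) = tape_of (h + shift d) (zact (w, d) z)"
proof (cases z)
  case (Pair l r)
  have S: "Suc (nat j) = nat (j + 1)" if "0 \<le> j" for j :: int
    using that by simp
  show ?thesis unfolding Pair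
    by (cases d)
      (auto simp: tape_of.simps fun_eq_iff nth_default_Cons_nat nth_default_tl hd0_nth_default S
        algebra_simps intro!: arg_cong[where f = "nth_default 0 _"])
qed

lemma zeq_refl [simp]: "zeq z z"
  by (simp add: zeq_def)

lemma zeq_keep [simp]: "zeq (l, hd0 r # tl r) (l, r)"
  by (cases r) (auto simp: zeq_def tape_of.simps fun_eq_iff nth_default_Cons split: nat.split)

lemma zeq_blank_right [simp]: "zeq (l, [0]) (l, [])" "zeq (l, [x, 0]) (l, [x])"
  by (auto simp: zeq_def tape_of.simps fun_eq_iff nth_default_Cons split: nat.split)

lemma zeq_blank_left [simp]: "zeq ([0], r) ([], r)"
  by (auto simp: zeq_def tape_of.simps fun_eq_iff nth_default_Cons split: nat.split)

section \<open>The machine\<close>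

text \<open>States 0 and 1 unpack an input tensor onto tape 3 as a list of one-letter items, each
  followed by a separator. States 2 to 4 transfer the list from tape 3 to tape 2, backwards, and
  find out whether it has a single item. If so, state 5 moves the item to the output. Otherwise
  the remaining states replace every four items \<open>x\<close>, \<open>y\<close>, \<open>z\<close>, \<open>w\<close> by
  \<open>[xx|yy][zz|ww]\<close>, moving the list to tape 3: for the \<open>p\<close>-th of them, state \<open>10 + 3p\<close> copies the
  item, \<open>11 + 3p\<close> rewinds and \<open>12 + 3p\<close> copies it again while erasing it. State 6 copies the
  second input list.\<close>

definition merge_trans :: "nat \<Rightarrow> nat list \<Rightarrow> nat \<times> (nat \<times> move) list" where
  "merge_trans q rs =
    (let i = rs ! 0; out = (rs ! 1, NoMove); u = rs ! 2; v = rs ! 3 in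
     if q = 0 then
       if i = 10 then (6, [(i, MoveRight), (10, MoveRight), (u, NoMove), (v, NoMove)])
       else if i = 9 then (2, [(i, MoveRight), out, (u, NoMove), (v, MoveLeft)])
       else (1, [(i, MoveRight), out, (u, NoMove), (if i = 1 then 3 else 2, MoveRight)])
     else if q = 1 then (0, [(i, NoMove), out, (u, NoMove), (9, MoveRight)])
     else if q = 2 then (3, [(i, NoMove), out, (v, MoveLeft), (0, MoveLeft)])
     else if q = 3 then
       if v = 0 then (5, [(i, NoMove), out, (u, MoveRight), (v, NoMove)])
       else (if v = 9 then 4 else 3, [(i, NoMove), out, (v, MoveLeft), (0, MoveLeft)])
     else if q = 4 then
       if v = 0 then (7, [(i, NoMove), out, (u, MoveRight), (v, NoMove)])
       else (4, [(i, NoMove), out, (v, MoveLeft), (0, MoveLeft)])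
     else if q = 5 then
       if u = 0 then (0, [(i, NoMove), out, (u, NoMove), (v, NoMove)])
       else (5, [(i, NoMove), (u, MoveRight), (0, MoveRight), (v, NoMove)])
     else if q = 6 then
       if i = 0 then (22, [(i, NoMove), out, (u, NoMove), (v, NoMove)])
       else (6, [(i, MoveRight), (i, MoveRight), (u, NoMove), (v, NoMove)])
     else if q = 7 then
       if u = 0 then (2, [(i, NoMove), out, (u, NoMove), (v, MoveLeft)])
       else (10, [(i, NoMove), out, (u, NoMove), (4, MoveRight)])
     else if q = 8 then (16, [(i, NoMove), out, (u, NoMove), (4, MoveRight)])
     else if q = 9 then (7, [(i, NoMove), out, (u, NoMove), (9, MoveRight)])
     else if q \<in> {10, 13, 16, 19} then
       if u = 9 then (q + 1, [(i, NoMove), out, (u, MoveLeft), (v, NoMove)])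
       else (q, [(i, NoMove), out, (u, MoveRight), (u, MoveRight)])
     else if q \<in> {11, 14, 17, 20} then
       if u = 0 then (q + 1, [(i, NoMove), out, (u, MoveRight), (v, NoMove)])
       else (q, [(i, NoMove), out, (u, MoveLeft), (v, NoMove)])
     else
       if u = 9 then
         (if q = 12 then 13 else if q = 15 then 8 else if q = 18 then 19 else 9,
          [(i, NoMove), out, (0, MoveRight), (if q \<in> {12, 18} then 5 else 6, MoveRight)])
       else (q, [(i, NoMove), out, (0, MoveRight), (u, MoveRight)]))"

definition merge_machine :: turing_machine where
  "merge_machine = \<lparr>tape_count = 4, state_count = 22, symbol_count = 11, trans = merge_trans\<rparr>"

lemma merge_machine_sel [simp]:
  "tape_count merge_machine = 4" "state_count merge_machine = 22"
  "symbol_count merge_machine = 11" "trans merge_machine = merge_trans"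
  by (simp_all add: merge_machine_def)

lemma token_code_range: "0 < token_code c \<and> token_code c < 11"
  by (cases c rule: token_code.cases) auto

lemma wf_merge_machine: "wf_machine merge_machine"
proof -
  have "case merge_trans q rs of (q', acts) \<Rightarrow>
          q' \<le> 22 \<and> length acts = 4 \<and> fst ` set acts \<subseteq> {..<11}"
    if q: "q < 22" and len: "length rs = 4" and sym: "set rs \<subseteq> {..<11}" for q rs
  proof -
    have "rs ! 0 < 11 \<and> rs ! 1 < 11 \<and> rs ! 2 < 11 \<and> rs ! 3 < 11"
      using len sym by (auto dest: nth_mem simp: subset_iff)
    then show ?thesis
      using q by (auto simp: merge_trans_def Let_def)
  qed
  then show ?thesis
    using token_code_range by (auto simp: wf_machine_def)
qed

text \<open>The absolute head position matters only on the output tape.\<close>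

definition conf :: "nat \<Rightarrow> nat list \<Rightarrow> nat list \<Rightarrow> zipper \<Rightarrow> zipper \<Rightarrow> config set" where
  "conf q inp out z2 z3 =
     {(q, [tape_of h0 (l0, inp), tape_of (int (length out)) (out, []), tape_of h2 z2, tape_of h3 z3])
      | h0 l0 h2 h3. True}"

section \<open>Timed Hoare triples\<close>

definition triple :: "config set \<Rightarrow> nat \<Rightarrow> config set \<Rightarrow> bool" where
  "triple P T Q \<longleftrightarrow> (\<forall>c \<in> P. \<exists>n \<le> T. (step merge_machine ^^ n) c \<in> Q)"

lemma triple_refl: "triple P T P"
  unfolding triple_def by (metis funpow_0 le0)

lemma triple_mono: "triple P T Q \<Longrightarrow> T \<le> T' \<Longrightarrow> triple P T' Q"
  unfolding triple_def by (meson order_trans)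

lemma triple_trans:
  assumes "triple P T Q" "triple Q T' R" shows "triple P (T + T') R"
  unfolding triple_def
proof
  fix c assume "c \<in> P"
  then obtain n where n: "n \<le> T" "(step merge_machine ^^ n) c \<in> Q"
    using assms by (auto simp: triple_def)
  then obtain m where "m \<le> T'" "(step merge_machine ^^ m) ((step merge_machine ^^ n) c) \<in> R"
    using assms by (auto simp: triple_def)
  then show "\<exists>n \<le> T + T'. (step merge_machine ^^ n) c \<in> R"
    using n by (intro exI[of _ "m + n"]) (auto simp: funpow_add)
qed

lemma triple_step:
  assumes "triple P 1 Q" "triple Q T R" shows "triple P (Suc T) R"
  using triple_trans[OF assms] by simp

text \<open>Isolates the format of the transitions that occur: the input is read-only and never
  scanned leftwards, and the output tape is either untouched or extended at its right end.
  Comparison up to \<open>zeq\<close> keeps stray blanks out of the resulting zippers.\<close>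

definition effect ::
  "nat \<times> (nat \<times> move) list \<Rightarrow> nat list \<Rightarrow> nat list \<Rightarrow> zipper \<Rightarrow> zipper \<Rightarrow>
   nat \<Rightarrow> nat list \<Rightarrow> nat list \<Rightarrow> zipper \<Rightarrow> zipper \<Rightarrow> bool" where
  "effect tr inp out z2 z3 q' inp' out' z2' z3' \<longleftrightarrow>
     (\<exists>d a1 a2 a3. tr = (q', [(hd0 inp, d), a1, a2, a3]) \<and>
       (d = NoMove \<and> inp' = inp \<or> d = MoveRight \<and> inp' = tl inp) \<and>
       (a1 = (0, NoMove) \<and> out' = out \<or> (\<exists>w. a1 = (w, MoveRight) \<and> out' = w # out)) \<and>
       zeq (zact a2 z2) z2' \<and> zeq (zact a3 z3) z3')"

lemma effect_eq [simp]:
  "effect (q, [(i, d), (w, d'), a2, a3]) inp out z2 z3 q' inp' out' z2' z3' \<longleftrightarrow>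
     q = q' \<and> i = hd0 inp \<and> (d = NoMove \<and> inp' = inp \<or> d = MoveRight \<and> inp' = tl inp) \<and>
     (w = 0 \<and> d' = NoMove \<and> out' = out \<or> d' = MoveRight \<and> out' = w # out) \<and>
     zeq (zact a2 z2) z2' \<and> zeq (zact a3 z3) z3'"
  by (auto simp: effect_def)

text \<open>Reduces a machine step to evaluating \<open>merge_trans\<close>. The second symbol read
  is always 0 because the output head stands just behind the output.\<close>

lemma conf_step:
  assumes q: "q < 22"
    and "effect (merge_trans q [hd0 inp, 0, hd0 (snd z2), hd0 (snd z3)]) inp out z2 z3
      q' inp' out' z2' z3'"
  shows "triple (conf q inp out z2 z3) 1 (conf q' inp' out' z2' z3')"
  unfolding triple_def
proof
  fix c assume "c \<in> conf q inp out z2 z3"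
  then obtain h0 l0 h2 h3 where c: "c = (q, [tape_of h0 (l0, inp),
      tape_of (int (length out)) (out, []), tape_of h2 z2, tape_of h3 z3])"
    by (auto simp: conf_def)
  obtain d a1 a2 a3 where
    tr: "merge_trans q [hd0 inp, 0, hd0 (snd z2), hd0 (snd z3)] =
      (q', [(hd0 inp, d), a1, a2, a3])"
    and inp: "d = NoMove \<and> inp' = inp \<or> d = MoveRight \<and> inp' = tl inp"
    and out: "a1 = (0, NoMove) \<and> out' = out \<or> (\<exists>w. a1 = (w, MoveRight) \<and> out' = w # out)"
    and z2: "zeq (zact a2 z2) z2'" and z3: "zeq (zact a3 z3) z3'"
    using assms(2) unfolding effect_def by blast
  have read: "(case tape_of h z of (f, h) \<Rightarrow> f h) = hd0 (snd z)" for h z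
    using tape_of_read[of h z] by (simp add: case_prod_beta)
  have step: "step merge_machine c = (q', [act (hd0 inp, d) (tape_of h0 (l0, inp)),
      act a1 (tape_of (int (length out)) (out, [])), act a2 (tape_of h2 z2), act a3 (tape_of h3 z3)])"
    using q tr by (simp add: c read)
  obtain g0 l where 0: "act (hd0 inp, d) (tape_of h0 (l0, inp)) = tape_of g0 (l, inp')"
    using inp zeq_keep[of l0 inp] by (auto simp: act_tape_of zeq_def)
  have 1: "act a1 (tape_of (int (length out)) (out, [])) = tape_of (int (length out')) (out', [])"
    using out zeq_blank_right(1)[of out] by (auto simp: act_tape_of zeq_def add.commute)
  obtain g2 where 2: "act a2 (tape_of h2 z2) = tape_of g2 z2'"
    using z2 by (cases a2) (auto simp: act_tape_of zeq_def)
  obtain g3 where 3: "act a3 (tape_of h3 z3) = tape_of g3 z3'"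
    using z3 by (cases a3) (auto simp: act_tape_of zeq_def)
  have "step merge_machine c \<in> conf q' inp' out' z2' z3'"
    unfolding step 0 1 2 3 conf_def by blast
  then show "\<exists>n \<le> 1. (step merge_machine ^^ n) c \<in> conf q' inp' out' z2' z3'"
    by (intro exI[of _ 1]) simp
qed

section \<open>Runs of the machine\<close>

text \<open>The scans stop at the blank 0 or at the separator 9 (\<open>ItemEnd\<close>), so neither
  may occur inside an item.\<close>

definition clean :: "nat list \<Rightarrow> bool" where
  "clean x \<longleftrightarrow> 0 \<notin> set x \<and> 9 \<notin> set x"

definition items :: "nat list list \<Rightarrow> nat list" where
  "items xs = concat (map (\<lambda>x. x @ [9]) xs)"

lemma items_simps [simp]: "items [] = []" "items (x # xs) = x @ 9 # items xs"
  "items (xs @ ys) = items xs @ items ys"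
  by (simp_all add: items_def)

text \<open>The head has stepped left from the boundary between \<open>l\<close> and
  \<open>r\<close>. For empty \<open>l\<close> it stands on the blank that ends a leftward
  scan.\<close>

definition rewound :: "nat list \<Rightarrow> nat list \<Rightarrow> zipper" where
  "rewound l r = (tl l, hd0 l # r)"

lemma rewound_simps [simp]: "rewound [] r = ([], 0 # r)" "rewound (x # l) r = (l, x # r)"
  by (simp_all add: rewound_def)

lemma zeq_rewound [simp]: "zeq (tl l, [hd0 l, 0]) (rewound l [])"
  by (simp add: rewound_def)

lemma zeq_rewound' [simp]: "zeq (tl l, hd0 l # r) (rewound l r)"
  by (simp add: rewound_def)

text \<open>Code 1 (\<open>L0\<close>) turns into 3 (\<open>LBot\<close>), which matches no letter
  of a tensor word; code 2 (\<open>L1\<close>) stays.\<close>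

definition leaf_code :: "nat \<Rightarrow> nat" where
  "leaf_code c = (if c = 1 then 3 else 2)"

section \<open>Loading, transferring and emitting lists of items\<close>

lemma load_run:
  assumes "set cs \<subseteq> {1, 2}"
  shows "triple (conf 0 (cs @ 9 # inp) out ([], []) (l, []))
    (2 * length cs + 1)
    (conf 2 inp out ([], []) (rewound (rev (items (map (\<lambda>c. [leaf_code c]) cs)) @ l) []))"
  using assms
proof (induction cs arbitrary: l)
  case Nil
  have "triple (conf 0 (9 # inp) out ([], []) (l, [])) 1 (conf 2 inp out ([], []) (rewound l []))"
    by (rule conf_step) (auto simp: merge_trans_def Let_def)
  then show ?case by simp
next
  case (Cons c cs)
  have 1: "triple (conf 0 (c # cs @ 9 # inp) out ([], []) (l, [])) 1
      (conf 1 (cs @ 9 # inp) out ([], []) (leaf_code c # l, []))"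
    using Cons.prems
    by (intro conf_step) (auto simp: merge_trans_def Let_def leaf_code_def)
  have 2: "triple (conf 1 (cs @ 9 # inp) out ([], []) (leaf_code c # l, [])) 1
      (conf 0 (cs @ 9 # inp) out ([], []) (9 # leaf_code c # l, []))"
    by (rule conf_step) (auto simp: merge_trans_def Let_def)
  show ?case
    using triple_step[OF 1 triple_step[OF 2 Cons.IH]] Cons.prems by simp
qed

text \<open>Both heads walk left, so the list keeps its order on tape 2.\<close>

lemma move_many_run:
  assumes "0 \<notin> set l"
  shows "triple (conf 4 inp out ([], 0 # r) (rewound l [])) (length l + 1)
    (conf 7 inp out ([], rev l @ r) ([], []))"
  using assms
proof (induction l arbitrary: r)
  case Nil
  have "triple (conf 4 inp out ([], 0 # r) ([], [0])) 1 (conf 7 inp out ([], r) ([], []))"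
    by (rule conf_step) (auto simp: merge_trans_def Let_def)
  then show ?case by simp
next
  case (Cons x l)
  have "triple (conf 4 inp out ([], 0 # r) (l, [x])) 1
      (conf 4 inp out ([], 0 # x # r) (rewound l []))"
    using Cons.prems
    by (intro conf_step) (auto simp: merge_trans_def Let_def)
  from triple_step[OF this Cons.IH] show ?case
    using Cons.prems by simp
qed

text \<open>In state 3 only the final separator has been passed; another 9 switches to state 4,
  where several items are known to exist.\<close>

lemma move_single_run:
  assumes "0 \<notin> set l"
  shows "triple (conf 3 inp out ([], 0 # r) (rewound l [])) (length l + 1)
    (conf (if 9 \<in> set l then 7 else 5) inp out ([], rev l @ r) ([], []))"
  using assms
proof (induction l arbitrary: r)
  case Nil
  have "triple (conf 3 inp out ([], 0 # r) ([], [0])) 1 (conf 5 inp out ([], r) ([], []))"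
    by (rule conf_step) (auto simp: merge_trans_def Let_def)
  then show ?case by simp
next
  case (Cons x l)
  have *: "triple (conf 3 inp out ([], 0 # r) (l, [x])) 1
      (conf (if x = 9 then 4 else 3) inp out ([], 0 # x # r) (rewound l []))"
    using Cons.prems
    by (intro conf_step) (auto simp: merge_trans_def Let_def)
  show ?case
  proof (cases "x = 9")
    case True
    with * have "triple (conf 3 inp out ([], 0 # r) (l, [x])) 1
      (conf 4 inp out ([], 0 # x # r) (rewound l []))" by simp
    from triple_step[OF this move_many_run] show ?thesis
      using Cons.prems True by simp
  next
    case False
    with * have "triple (conf 3 inp out ([], 0 # r) (l, [x])) 1
      (conf 3 inp out ([], 0 # x # r) (rewound l []))" by simp
    from triple_step[OF this Cons.IH] show ?thesis
      using Cons.prems False by simp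
  qed
qed

text \<open>State 2 consumes the final separator, so a 9 left in \<open>u\<close> means at least two
  items and leads to merging (7), while its absence leads to output (5).\<close>

lemma move_run:
  assumes "0 \<notin> set u"
  shows "triple (conf 2 inp out ([], []) (rewound (9 # rev u) [])) (length u + 2)
    (conf (if 9 \<in> set u then 7 else 5) inp out ([], u @ [9]) ([], []))"
proof -
  have "triple (conf 2 inp out ([], []) (rev u, [9])) 1
      (conf 3 inp out ([], [0, 9]) (rewound (rev u) []))"
    by (rule conf_step) (auto simp: merge_trans_def Let_def)
  from triple_step[OF this move_single_run] show ?thesis
    using assms by simp
qed

lemma emit_run:
  assumes "0 \<notin> set u"
  shows "triple (conf 5 inp out ([], u) ([], [])) (length u + 1)
    (conf 0 inp (rev u @ out) ([], []) ([], []))"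
  using assms
proof (induction u arbitrary: out)
  case Nil
  have "triple (conf 5 inp out ([], []) ([], [])) 1 (conf 0 inp out ([], []) ([], []))"
    by (rule conf_step) (auto simp: merge_trans_def Let_def)
  then show ?case by simp
next
  case (Cons x u)
  have "triple (conf 5 inp out ([], x # u) ([], [])) 1 (conf 5 inp (x # out) ([], u) ([], []))"
    using Cons.prems
    by (intro conf_step) (auto simp: merge_trans_def Let_def)
  from triple_step[OF this Cons.IH] show ?case
    using Cons.prems by simp
qed

lemma copy_run:
  assumes "0 \<notin> set inp"
  shows "triple (conf 6 inp out z2 z3) (length inp + 1) (conf 22 [] (rev inp @ out) z2 z3)"
  using assms
proof (induction inp arbitrary: out)
  case Nil
  have "triple (conf 6 [] out z2 z3) 1 (conf 22 [] out z2 z3)"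
    by (cases z2; cases z3; simp only:; rule conf_step)
      (auto simp: merge_trans_def Let_def)
  then show ?case by simp
next
  case (Cons x inp)
  have "triple (conf 6 (x # inp) out z2 z3) 1 (conf 6 inp (x # out) z2 z3)"
    using Cons.prems
    by (cases z2; cases z3; simp only:; intro conf_step)
      (auto simp: merge_trans_def Let_def)
  from triple_step[OF this Cons.IH] show ?case
    using Cons.prems by simp
qed

section \<open>Doubling an item\<close>

lemma merge_trans_scan:
  assumes "q \<in> {10, 13, 16, 19}"
  shows "merge_trans q [i, w, u, v] =
    (if u = 9 then (q + 1, [(i, NoMove), (w, NoMove), (u, MoveLeft), (v, NoMove)])
     else (q, [(i, NoMove), (w, NoMove), (u, MoveRight), (u, MoveRight)]))"
  using assms unfolding merge_trans_def Let_def
  by (elim insertE emptyE; hypsubst; simp only: nth_Cons_0 nth_Cons_numeral; simp)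

lemma merge_trans_back:
  assumes "q \<in> {11, 14, 17, 20}"
  shows "merge_trans q [i, w, u, v] =
    (if u = 0 then (q + 1, [(i, NoMove), (w, NoMove), (u, MoveRight), (v, NoMove)])
     else (q, [(i, NoMove), (w, NoMove), (u, MoveLeft), (v, NoMove)]))"
  using assms unfolding merge_trans_def Let_def
  by (elim insertE emptyE; hypsubst; simp only: nth_Cons_0 nth_Cons_numeral; simp)

lemma merge_trans_rescan:
  assumes "(q, q', s) \<in> {(12, 13, 5), (15, 8, 6), (18, 19, 5), (21, 9, 6)}"
  shows "merge_trans q [i, w, u, v] =
    (if u = 9 then (q', [(i, NoMove), (w, NoMove), (0, MoveRight), (s, MoveRight)])
     else (q, [(i, NoMove), (w, NoMove), (0, MoveRight), (u, MoveRight)]))"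
  using assms unfolding merge_trans_def Let_def
  by (elim insertE emptyE; simp only: prod.inject; elim conjE; hypsubst;
      simp only: nth_Cons_0 nth_Cons_numeral; simp)

lemma scan_run:
  assumes "q \<in> {10, 13, 16, 19}" "9 \<notin> set x"
  shows "triple (conf q inp out (l2, x @ 9 # r) (l3, [])) (length x + 1)
    (conf (q + 1) inp out (rewound (rev x @ l2) (9 # r)) (rev x @ l3, []))"
  using assms(2)
proof (induction x arbitrary: l2 l3)
  case Nil
  have "triple (conf q inp out (l2, 9 # r) (l3, [])) 1
      (conf (q + 1) inp out (rewound l2 (9 # r)) (l3, []))"
    using assms(1)
    by (intro conf_step) (auto simp: merge_trans_scan[OF assms(1)])
  then show ?case by simp
next
  case (Cons c x)
  have "triple (conf q inp out (l2, c # x @ 9 # r) (l3, [])) 1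
      (conf q inp out (c # l2, x @ 9 # r) (c # l3, []))"
    using assms(1) Cons.prems
    by (intro conf_step) (auto simp: merge_trans_scan[OF assms(1)])
  from triple_step[OF this Cons.IH] show ?case
    using Cons.prems by simp
qed

lemma back_run:
  assumes "q \<in> {11, 14, 17, 20}" "0 \<notin> set l"
  shows "triple (conf q inp out (rewound l r) (l3, [])) (length l + 1)
    (conf (q + 1) inp out ([], rev l @ r) (l3, []))"
  using assms(2)
proof (induction l arbitrary: r)
  case Nil
  have "triple (conf q inp out ([], 0 # r) (l3, [])) 1 (conf (q + 1) inp out ([], r) (l3, []))"
    using assms(1)
    by (intro conf_step) (auto simp: merge_trans_back[OF assms(1)])
  then show ?case by simp
next
  case (Cons c l)
  have "triple (conf q inp out (l, c # r) (l3, [])) 1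
      (conf q inp out (rewound l (c # r)) (l3, []))"
    using assms(1) Cons.prems
    by (intro conf_step) (auto simp: merge_trans_back[OF assms(1)])
  from triple_step[OF this Cons.IH] show ?case
    using Cons.prems by simp
qed

text \<open>Erased cells are blanks at the outer left end and vanish up to \<open>zeq\<close>. Hence
  the left part stays empty, and the next item again starts behind a blank, where its own rewind
  will stop.\<close>

lemma rescan_run:
  assumes "(q, q', s) \<in> {(12, 13, 5), (15, 8, 6), (18, 19, 5), (21, 9, 6)}" "9 \<notin> set x"
  shows "triple (conf q inp out ([], x @ 9 # r) (l3, [])) (length x + 1)
    (conf q' inp out ([], r) (s # rev x @ l3, []))"
  using assms(2)
proof (induction x arbitrary: l3)
  case Nil
  have "triple (conf q inp out ([], 9 # r) (l3, [])) 1 (conf q' inp out ([], r) (s # l3, []))"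
    using assms(1)
    by (intro conf_step) (auto simp: merge_trans_rescan[OF assms(1)])
  then show ?case by simp
next
  case (Cons c x)
  have "triple (conf q inp out ([], c # x @ 9 # r) (l3, [])) 1
      (conf q inp out ([], x @ 9 # r) (c # l3, []))"
    using assms(1) Cons.prems
    by (intro conf_step) (auto simp: merge_trans_rescan[OF assms(1)])
  from triple_step[OF this Cons.IH] show ?case
    using Cons.prems by simp
qed

text \<open>Three sweeps of \<open>length x + 1\<close> steps each: copy, rewind, copy while
  erasing. \<open>s\<close> is the \<open>Bar\<close> or \<open>RBrack\<close> that follows the
  doubled item.\<close>

lemma duplicate_run:
  assumes q: "(q, q', s) \<in> {(10, 13, 5), (13, 8, 6), (16, 19, 5), (19, 9, 6)}"
    and x: "clean x"
  shows "triple (conf q inp out ([], x @ 9 # r) (l3, [])) (3 * length x + 3)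
    (conf q' inp out ([], r) (s # rev (x @ x) @ l3, []))"
proof -
  have x': "0 \<notin> set x" "9 \<notin> set x"
    using x by (auto simp: clean_def)
  have 1: "triple (conf q inp out ([], x @ 9 # r) (l3, [])) (length x + 1)
      (conf (q + 1) inp out (rewound (rev x) (9 # r)) (rev x @ l3, []))"
    using scan_run[of q x inp out "[]" r l3] q x' by auto
  have 2: "triple (conf (q + 1) inp out (rewound (rev x) (9 # r)) (rev x @ l3, [])) (length x + 1)
      (conf (q + 2) inp out ([], x @ 9 # r) (rev x @ l3, []))"
    using back_run[of "q + 1" "rev x" inp out "9 # r" "rev x @ l3"] q x' by auto
  have 3: "triple (conf (q + 2) inp out ([], x @ 9 # r) (rev x @ l3, [])) (length x + 1)
      (conf q' inp out ([], r) (s # rev x @ rev x @ l3, []))"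
    using rescan_run[of "q + 2" q' s x inp out r "rev x @ l3"] q x' by auto
  show ?thesis
    using triple_mono[OF triple_trans[OF 1 triple_trans[OF 2 3]], of "3 * length x + 3"] by simp
qed

section \<open>Merging passes and their running time\<close>

definition merge4 :: "nat list \<Rightarrow> nat list \<Rightarrow> nat list \<Rightarrow> nat list \<Rightarrow> nat list" where
  "merge4 x y z w = 4 # x @ x @ 5 # y @ y @ 6 # 4 # z @ z @ 5 # w @ w @ [6]"

fun merge :: "nat list list \<Rightarrow> nat list list" where
  "merge (x # y # z # w # xs) = merge4 x y z w # merge xs"
| "merge _ = []"

text \<open>Four duplications of \<open>3 * m + 3\<close> steps, plus one step for each of the two
  opening brackets and the closing separator.\<close>

lemma group_run:
  assumes "clean x" "clean y" "clean z" "clean w"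
    and len: "length x \<le> m" "length y \<le> m" "length z \<le> m" "length w \<le> m"
  shows "triple (conf 7 inp out ([], items [x, y, z, w] @ r) (l3, [])) (12 * m + 15)
    (conf 7 inp out ([], r) (rev (items [merge4 x y z w]) @ l3, []))"
proof -
  \<comment> \<open>State 7 takes a blank for the end of the list, so the first symbol must not be
    one.\<close>
  have hd: "hd0 (x @ 9 # r') \<noteq> 0" for r'
    using assms(1) by (cases x) (auto simp: clean_def)
  have 1: "triple (conf 7 inp out ([], x @ 9 # y @ 9 # z @ 9 # w @ 9 # r) (l3, [])) 1
      (conf 10 inp out ([], x @ 9 # y @ 9 # z @ 9 # w @ 9 # r) (4 # l3, []))"
    by (rule conf_step) (auto simp: merge_trans_def Let_def hd)
  have 2: "triple (conf 8 inp out ([], r2) (l2, [])) 1 (conf 16 inp out ([], r2) (4 # l2, []))"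
    for l2 r2
    by (rule conf_step) (auto simp: merge_trans_def Let_def)
  have 3: "triple (conf 9 inp out ([], r2) (l2, [])) 1 (conf 7 inp out ([], r2) (9 # l2, []))"
    for l2 r2
    by (rule conf_step) (auto simp: merge_trans_def Let_def)
  have d: "triple (conf q inp out ([], v @ 9 # r2) (l2, [])) (3 * m + 3)
      (conf q' inp out ([], r2) (s # rev v @ rev v @ l2, []))"
    if "(q, q', s) \<in> {(10, 13, 5), (13, 8, 6), (16, 19, 5), (19, 9, 6)}" "clean v" "length v \<le> m"
    for q q' s v r2 l2
    using triple_mono[OF duplicate_run[OF that(1,2)], of "3 * m + 3"] that(3) by simp
  note t = triple_trans[OF 1 triple_trans[OF d[of 10 13 5 x] triple_trans[OF d[of 13 8 6 y]
        triple_trans[OF 2 triple_trans[OF d[of 16 19 5 z] triple_trans[OF d[of 19 9 6 w] 3]]]]]]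
  have "triple (conf 7 inp out ([], items [x, y, z, w] @ r) (l3, []))
    (1 + (3 * m + 3 + (3 * m + 3 + (1 + (3 * m + 3 + (3 * m + 3 + 1))))))
    (conf 7 inp out ([], r) (rev (items [merge4 x y z w]) @ l3, []))"
    using t assms by (simp add: merge4_def)
  then show ?thesis
    by (rule triple_mono) simp
qed

lemma pass_run:
  assumes "length xs = 4 * n" "\<forall>x \<in> set xs. clean x \<and> length x \<le> m"
  shows "triple (conf 7 inp out ([], items xs) (l3, [])) (n * (12 * m + 15) + 1)
    (conf 2 inp out ([], []) (rewound (rev (items (merge xs)) @ l3) []))"
  using assms
proof (induction n arbitrary: xs l3)
  case 0
  have "triple (conf 7 inp out ([], []) (l3, [])) 1 (conf 2 inp out ([], []) (rewound l3 []))"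
    by (rule conf_step) (auto simp: merge_trans_def Let_def)
  then show ?case using 0 by simp
next
  case (Suc n)
  obtain x y z w xs' where xs: "xs = x # y # z # w # xs'"
    using Suc.prems(1) by (auto simp: numeral_eq_Suc length_Suc_conv)
  have "triple (conf 7 inp out ([], items [x, y, z, w] @ items xs') (l3, [])) (12 * m + 15)
    (conf 7 inp out ([], items xs') (rev (items [merge4 x y z w]) @ l3, []))"
    using Suc.prems(2) by (intro group_run) (auto simp: xs)
  from triple_trans[OF this Suc.IH] show ?case
    using Suc.prems by (simp add: xs add.assoc)
qed

text \<open>Each of four items occurs twice, and six brackets and bars are added, whence
  \<open>8 * m + 6\<close>.\<close>

lemma merge_props:
  assumes "length xs = 4 * n" "\<forall>x \<in> set xs. clean x \<and> length x \<le> m"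
  shows "length (merge xs) = n \<and> (\<forall>x \<in> set (merge xs). clean x \<and> length x \<le> 8 * m + 6)"
  using assms
proof (induction n arbitrary: xs)
  case (Suc n)
  obtain x y z w xs' where xs: "xs = x # y # z # w # xs'"
    using Suc.prems(1) by (auto simp: numeral_eq_Suc length_Suc_conv)
  have "length (merge xs') = n \<and> (\<forall>x \<in> set (merge xs'). clean x \<and> length x \<le> 8 * m + 6)"
    using Suc.prems by (intro Suc.IH) (simp_all add: xs)
  moreover have "clean (merge4 x y z w)"
    using Suc.prems(2) by (simp add: xs merge4_def clean_def)
  moreover have "length (merge4 x y z w) \<le> 8 * m + 6"
    using Suc.prems(2) by (simp add: xs merge4_def)
  ultimately show ?case
    by (simp add: xs)
qed simp

lemma length_items: "\<forall>x \<in> set xs. length x \<le> m \<Longrightarrow> length (items xs) \<le> length xs * (m + 1)"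
  by (induction xs) auto

lemma zero_notin_items: "\<forall>x \<in> set xs. clean x \<Longrightarrow> 0 \<notin> set (items xs)"
  by (induction xs) (auto simp: clean_def)

text \<open>The summands of a pass are the transfer of \<open>4 ^ Suc k\<close> items to tape 2, the
  merging of \<open>4 ^ k\<close> groups, and the later passes on longer items. A single item is
  merely transferred.\<close>

fun merge_time :: "nat \<Rightarrow> nat \<Rightarrow> nat" where
  "merge_time 0 m = m + 2"
| "merge_time (Suc k) m =
     (4 ^ Suc k * (m + 1) + 1) + ((4 ^ k * (12 * m + 15) + 1) + merge_time k (8 * m + 6))"

lemma merge_run:
  assumes "length xs = 4 ^ k" "\<forall>x \<in> set xs. clean x \<and> length x \<le> m"
  shows "triple (conf 2 inp out ([], []) (rewound (rev (items xs)) [])) (merge_time k m)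
    (conf 5 inp out ([], items ((merge ^^ k) xs)) ([], []))"
  using assms
proof (induction k arbitrary: xs m)
  case 0
  then obtain x where xs: "xs = [x]"
    by (auto simp: length_Suc_conv)
  then have "0 \<notin> set x" "9 \<notin> set x" "length x \<le> m"
    using 0 by (auto simp: clean_def)
  then show ?case
    using triple_mono[OF move_run[of x inp out], of "m + 2"] by (simp add: xs)
next
  case (Suc k)
  \<comment> \<open>The list without its final separator, the form required by
    \<open>move_run\<close>; having at least two items, it still contains a 9.\<close>
  define u where "u = items (butlast xs) @ last xs"
  have len: "length xs \<ge> 2"
    using Suc.prems(1) by (simp add: Suc_le_eq)
  then have ne: "xs \<noteq> []" "butlast xs \<noteq> []"
    by (auto simp: length_0_conv[symmetric] simp del: length_0_conv)
  have u: "items xs = u @ [9]"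
    unfolding u_def by (subst append_butlast_last_id[OF ne(1), symmetric], subst items_simps(3)) simp
  have z: "0 \<notin> set u"
    using zero_notin_items[of xs] Suc.prems(2) u by auto
  have n: "9 \<in> set u"
    using ne(2) by (cases "butlast xs") (auto simp: u_def)
  have lu: "length u + 2 \<le> 4 ^ Suc k * (m + 1) + 1"
    using length_items[of xs m] Suc.prems by (simp add: u)
  have 1: "triple (conf 2 inp out ([], []) (rewound (rev (items xs)) [])) (4 ^ Suc k * (m + 1) + 1)
      (conf 7 inp out ([], items xs) ([], []))"
    using triple_mono[OF move_run[OF z, of inp out] lu] n by (simp add: u)
  have 2: "triple (conf 7 inp out ([], items xs) ([], [])) (4 ^ k * (12 * m + 15) + 1)
      (conf 2 inp out ([], []) (rewound (rev (items (merge xs))) []))"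
    using pass_run[of xs "4 ^ k" m inp out "[]"] Suc.prems by simp
  have 3: "triple (conf 2 inp out ([], []) (rewound (rev (items (merge xs))) []))
      (merge_time k (8 * m + 6)) (conf 5 inp out ([], items ((merge ^^ k) (merge xs))) ([], []))"
  proof (rule Suc.IH)
    show "length (merge xs) = 4 ^ k" "\<forall>x \<in> set (merge xs). clean x \<and> length x \<le> 8 * m + 6"
      using merge_props[of xs "4 ^ k" m] Suc.prems by simp_all
  qed
  show ?case
    using triple_trans[OF 1 triple_trans[OF 2 3]] by (simp add: funpow_Suc_right del: funpow.simps)
qed

text \<open>From pass to pass \<open>m + 1\<close> grows at most eightfold, and one pass costs at
  most \<open>28 * 8 ^ k * (m + 1)\<close>, which is below \<open>4 * 8 ^ Suc k * (m + 1)\<close>.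
  So each pass adds 4 to the linear factor.\<close>

lemma merge_time_le: "merge_time k m \<le> (3 + 4 * k) * 8 ^ k * (m + 1)"
proof (induction k arbitrary: m)
  case (Suc k)
  have "4 ^ k * (16 * m + 21) \<le> (8 ^ k * (28 * (m + 1)) - 2 :: nat)"
  proof -
    have "(4 :: nat) ^ k \<le> 8 ^ k" "(1 :: nat) \<le> 8 ^ k"
      by (auto intro: power_mono)
    then have "4 ^ k * (16 * m + 21) \<le> 8 ^ k * (16 * m + 21)"
      and "2 \<le> (8 :: nat) ^ k * (12 * m + 7)"
      by (auto intro: order_trans[OF _ mult_mono[of 1 _ 2]])
    then show ?thesis by (simp add: algebra_simps)
  qed
  \<comment> \<open>Excludes truncation in the subtraction of 2 above, which makes room for the two
    closing steps of a pass.\<close>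
  moreover have "2 \<le> (8 ^ k * (28 * (m + 1)) :: nat)"
    by (rule order_trans[OF _ mult_mono[of 1 _ 2]]) auto
  moreover have "merge_time k (8 * m + 6) \<le> (3 + 4 * k) * 8 ^ k * (8 * (m + 1))"
    by (rule order_trans[OF Suc.IH]) (intro mult_left_mono, auto)
  ultimately have "merge_time (Suc k) m \<le>
      8 ^ k * (28 * (m + 1)) + (3 + 4 * k) * 8 ^ k * (8 * (m + 1))"
    by (simp add: algebra_simps)
  also have "\<dots> \<le> (3 + 4 * Suc k) * 8 ^ Suc k * (m + 1)"
    by (simp add: algebra_simps)
  finally show ?case .
qed simp

section \<open>The regular expression of a tensor\<close>

text \<open>One level consumes an average coordinate \<open>i\<close> and the maximum coordinate
  \<open>j\<close> after it, so \<open>k\<close> levels serve \<open>2 * k\<close>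
  coordinates.\<close>

fun tensor_regex :: "nat \<Rightarrow> (nat list \<Rightarrow> nat) \<Rightarrow> letter regex" where
  "tensor_regex 0 a = Sym (if a [] = 0 then LBot else L1)"
| "tensor_regex (Suc k) a =
     (let r = \<lambda>i j. tensor_regex k (\<lambda>l. a (i # j # l)) in
      Cat (Alt (Cat (r 0 0) (r 0 0)) (Cat (r 0 1) (r 0 1)))
          (Alt (Cat (r 1 0) (r 1 0)) (Cat (r 1 1) (r 1 1))))"

definition tensor_word :: "nat \<Rightarrow> (nat list \<Rightarrow> nat) \<Rightarrow> letter list" where
  "tensor_word t b = map (\<lambda>i. if b i = 0 then L0 else L1) (index_list t)"

text \<open>The second input list already is the list of output strings, which is why state 6 only
  copies.\<close>

lemma tensor_text_word: "tensor_text t b = map Letter (tensor_word t b)"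
  by (simp add: tensor_text_def tensor_word_def)

lemma length_index_list [simp]: "length (index_list t) = 2 ^ t"
  by (induction t) auto

lemma set_index_list: "set (index_list t) = indices t"
  by (induction t) (auto simp: indices_def image_iff length_Suc_conv)

lemma Cons_in_indices [simp]: "i # l \<in> indices (Suc n) \<longleftrightarrow> i \<in> {0, 1} \<and> l \<in> indices n"
  by (auto simp: indices_def)

lemma Nil_in_indices [simp]: "[] \<in> indices 0"
  by (simp add: indices_def)

lemma indices_Suc_cases:
  assumes "i \<in> indices (Suc n)"
  obtains c l where "i = c # l" "c \<in> {0, 1}" "l \<in> indices n"
  using assms by (cases i) (auto simp: indices_def)

section \<open>Length and injectivity of the encoding\<close>

fun tensor_regex_length :: "nat \<Rightarrow> nat" where
  "tensor_regex_length 0 = 1"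
| "tensor_regex_length (Suc k) = 8 * tensor_regex_length k + 6"

lemma length_tensor_regex: "length (regex_text (tensor_regex k a)) = tensor_regex_length k"
  by (induction k arbitrary: a) (simp_all add: Let_def)

lemma tensor_regex_length_le: "tensor_regex_length k + 1 \<le> 2 * 8 ^ k"
  by (induction k) auto

text \<open>All expressions of one level have texts of equal length, so equal texts split at the
  same places into equal texts of the subexpressions.\<close>

lemma tensor_regex_text_eqD:
  assumes "regex_text (tensor_regex k a) = regex_text (tensor_regex k a')" "i \<in> indices (2 * k)"
  shows "a i = 0 \<longleftrightarrow> a' i = 0"
  using assms
proof (induction k arbitrary: a a' i)
  case 0
  then show ?case by (auto simp: indices_def split: if_splits)
next
  case (Suc k)
  obtain c d l where i: "i = c # d # l" "c \<in> {0, 1}" "d \<in> {0, 1}" "l \<in> indices (2 * k)"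
    using Suc.prems(2) by (auto elim!: indices_Suc_cases)
  have "regex_text (tensor_regex k (\<lambda>l. a (c # d # l))) =
      regex_text (tensor_regex k (\<lambda>l. a' (c # d # l)))" if "c \<in> {0, 1}" "d \<in> {0, 1}" for c d
    using Suc.prems(1) that
    by (auto simp: Let_def length_tensor_regex)
  then show ?case
    unfolding i(1) using i(2-4) by (intro Suc.IH[of "\<lambda>l. a (c # d # l)" "\<lambda>l. a' (c # d # l)" l])
qed

lemma tensors_eqI:
  assumes "a \<in> tensors t" "a' \<in> tensors t" "\<And>i. i \<in> indices t \<Longrightarrow> a i = 0 \<longleftrightarrow> a' i = 0"
  shows "a = a'"
proof (rule PiE_ext)
  show "a \<in> indices t \<rightarrow>\<^sub>E {0, 1}" "a' \<in> indices t \<rightarrow>\<^sub>E {0, 1}"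
    using assms by (auto simp: tensors_def)
  fix i assume i: "i \<in> indices t"
  then have "a i \<in> {0, 1}" "a' i \<in> {0, 1}"
    using assms(1,2) by (auto simp: tensors_def)
  then show "a i = a' i" using assms(3)[OF i] by auto
qed

text \<open>Stronger than injectivity of \<open>tensor_regex\<close>, since a text forgets how
  concatenations associate.\<close>

lemma inj_tensor_regex_text: "inj_on (\<lambda>a. regex_text (tensor_regex k a)) (tensors (2 * k))"
  by (rule inj_onI) (auto intro: tensors_eqI dest: tensor_regex_text_eqD)

lemma inj_tensor_word: "inj_on (tensor_word t) (tensors t)"
proof (rule inj_onI)
  fix b b' assume "b \<in> tensors t" "b' \<in> tensors t" "tensor_word t b = tensor_word t b'"
  then show "b = b'"
    by (intro tensors_eqI) (auto simp: tensor_word_def set_index_list split: if_splits)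
qed

section \<open>Similarity\<close>

definition agreement :: "'a list \<Rightarrow> 'a list \<Rightarrow> nat" where
  "agreement x y = length (filter (\<lambda>(c, d). c = d) (zip x y))"

lemma agreement_append [simp]:
  "length x = length y \<Longrightarrow> agreement (x @ x') (y @ y') = agreement x y + agreement x' y'"
  by (simp add: agreement_def)

lemma HamSim_agreement:
  assumes "length x = length y"
  shows "HamSim x y = real (agreement x y) / real (length y)"
proof -
  have "{j. j < length x \<and> x ! j = y ! j} =
      {j. j < length (zip x y) \<and> (\<lambda>(c, d). c = d) (zip x y ! j)}"
    using assms by auto
  then show ?thesis
    using assms by (simp add: HamSim_def agreement_def length_filter_conv_card)
qed

text \<open>Unnormalised \<open>MaxSim\<close> for expressions all of whose words have the length of
  \<open>y\<close>; in this form values add under concatenation.\<close>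

definition best_agreement :: "'a regex \<Rightarrow> 'a list \<Rightarrow> real \<Rightarrow> bool" where
  "best_agreement r y v \<longleftrightarrow>
     (\<forall>x \<in> lang r. length x = length y \<and> real (agreement x y) \<le> v) \<and>
     (\<exists>x \<in> lang r. real (agreement x y) = v)"

lemma best_agreement_Sym: "best_agreement (Sym c) [d] (if c = d then 1 else 0)"
  by (simp add: best_agreement_def agreement_def)

text \<open>The fixed lengths force every word to split exactly between \<open>y\<close> and
  \<open>y'\<close>, so the two parts are optimised independently.\<close>

lemma best_agreement_Cat:
  assumes "best_agreement r y v" "best_agreement s y' v'"
  shows "best_agreement (Cat r s) (y @ y') (v + v')"
proof -
  obtain x x' where x: "x \<in> lang r" "real (agreement x y) = v" "length x = length y"
    "x' \<in> lang s" "real (agreement x' y') = v'"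
    using assms by (auto simp: best_agreement_def)
  then have "x @ x' \<in> lang (Cat r s) \<and> real (agreement (x @ x') (y @ y')) = v + v'"
    by auto
  moreover have "\<forall>x \<in> lang (Cat r s).
      length x = length (y @ y') \<and> real (agreement x (y @ y')) \<le> v + v'"
    using assms by (fastforce simp: best_agreement_def intro: add_mono)
  ultimately show ?thesis
    unfolding best_agreement_def by blast
qed

lemma best_agreement_Alt:
  assumes "best_agreement r y v" "best_agreement s y v'"
  shows "best_agreement (Alt r s) y (max v v')"
  using assms unfolding best_agreement_def by (fastforce simp: max_def)

lemma MaxSim_best_agreement:
  assumes "best_agreement r y v"
  shows "MaxSim r y = v / real (length y)" and "\<exists>x \<in> lang r. length x = length y"
proof -
  show "\<exists>x \<in> lang r. length x = length y"
    using assms by (auto simp: best_agreement_def)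
  let ?S = "{HamSim x y | x. x \<in> lang r \<and> length x = length y}"
  have "agreement x y \<le> length y" for x
    unfolding agreement_def by (rule order_trans[OF length_filter_le]) simp
  \<comment> \<open>Only finitely many similarities are possible, so \<open>Max\<close> is a true
    maximum.\<close>
  then have "?S \<subseteq> (\<lambda>n. real n / real (length y)) ` {..length y}"
    by (auto simp: HamSim_agreement)
  then have "finite ?S"
    by (rule finite_subset) simp
  moreover have "s \<le> v / real (length y)" if "s \<in> ?S" for s
    using that assms by (auto simp: HamSim_agreement best_agreement_def intro!: divide_right_mono)
  moreover have "v / real (length y) \<in> ?S"
  proof -
    obtain x where "x \<in> lang r" "real (agreement x y) = v" "length x = length y"
      using assms by (auto simp: best_agreement_def)
    then show ?thesis
      by (intro CollectI exI[of _ x]) (simp add: HamSim_agreement)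
  qed
  ultimately show "MaxSim r y = v / real (length y)"
    unfolding MaxSim_def by (intro Max_eqI) auto
qed

lemma tensor_word_Suc:
  "tensor_word (Suc n) b = tensor_word n (\<lambda>l. b (0 # l)) @ tensor_word n (\<lambda>l. b (1 # l))"
  by (simp add: tensor_word_def o_def)

text \<open>Prepending two coordinates preserves the parity of positions; and changing
  \<open>d\<close> affects only position 1, a maximum coordinate.\<close>

lemma max_invariant_SucSuc:
  assumes "max_invariant (Suc (Suc n)) b" "c \<in> {0, 1}"
  shows "d \<in> {0, 1} \<Longrightarrow> max_invariant n (\<lambda>l. b (c # d # l))"
    and "l \<in> indices n \<Longrightarrow> b (c # 1 # l) = b (c # 0 # l)"
proof -
  assume d: "d \<in> {0, 1}"
  show "max_invariant n (\<lambda>l. b (c # d # l))"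
    unfolding max_invariant_def
  proof (intro ballI impI)
    fix i j assume ij: "i \<in> indices n" "j \<in> indices n" "\<forall>k<n. even k \<longrightarrow> i ! k = j ! k"
    have "(c # d # i) ! k = (c # d # j) ! k" if "k < Suc (Suc n)" "even k" for k
      using that ij(3) by (cases k; cases "k - 1") auto
    then show "b (c # d # i) = b (c # d # j)"
      using assms d ij unfolding max_invariant_def by (metis Cons_in_indices)
  qed
next
  assume l: "l \<in> indices n"
  have "(c # 1 # l) ! k = (c # 0 # l) ! k" if "even k" for k
    using that by (cases k; cases "k - 1") auto
  moreover have "c # 1 # l \<in> indices (Suc (Suc n))" "c # 0 # l \<in> indices (Suc (Suc n))"
    using assms(2) l by auto
  ultimately show "b (c # 1 # l) = b (c # 0 # l)"
    using assms(1) unfolding max_invariant_def by blast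
qed

text \<open>Per level the factor 4 arises as 2 from a sum in place of a mean and 2 from the repeated
  expressions.\<close>

lemma best_agreement_tensor:
  assumes "max_invariant (2 * k) b"
    and "\<forall>i \<in> indices (2 * k). a i \<in> {0, 1} \<and> b i \<in> {0, 1}"
  shows "best_agreement (tensor_regex k a) (tensor_word (2 * k) b)
    (4 ^ k * avg_level (2 * k) (\<lambda>i. real (a i * b i)))"
  using assms
proof (induction k arbitrary: a b)
  case 0
  then have "a [] \<in> {0, 1} \<and> b [] \<in> {0, 1}"
    by simp
  \<comment> \<open>The letters agree only as \<open>L1\<close> against \<open>L1\<close>, so the
    agreement is the product of the entries.\<close>
  then show ?case
    using best_agreement_Sym[of "if a [] = 0 then LBot else L1" "if b [] = 0 then L0 else L1"]
    by (auto simp: tensor_word_def)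
next
  case (Suc k)
  define r where "r c d = tensor_regex k (\<lambda>l. a (c # d # l))" for c d
  define y where "y c d = tensor_word (2 * k) (\<lambda>l. b (c # d # l))" for c d
  define v where "v c d = avg_level (2 * k) (\<lambda>l. real (a (c # d # l) * b (c # d # l)))" for c d
  have inv: "max_invariant (Suc (Suc (2 * k))) b"
    using Suc.prems(1) by simp
  have best: "best_agreement (r c d) (y c d) (4 ^ k * v c d)" if "c \<in> {0, 1}" "d \<in> {0, 1}" for c d
    unfolding r_def y_def v_def using Suc.prems(2) that
    by (intro Suc.IH max_invariant_SucSuc(1)[OF inv]) auto
  \<comment> \<open>Max-invariance makes both quarters of a half equal, so a doubled expression
    meets the same string twice.\<close>
  have y: "y c 1 = y c 0" if "c \<in> {0, 1}" for c
    using max_invariant_SucSuc(2)[OF inv that]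
    by (auto simp: y_def tensor_word_def set_index_list)
  have half: "best_agreement (Alt (Cat (r c 0) (r c 0)) (Cat (r c 1) (r c 1))) (y c 0 @ y c 1)
      (2 * 4 ^ k * max (v c 0) (v c 1))" if c: "c \<in> {0, 1}" for c
  proof -
    have "best_agreement (Cat (r c d) (r c d)) (y c 0 @ y c 1) (4 ^ k * v c d + 4 ^ k * v c d)"
      if "d \<in> {0, 1}" for d
      using best_agreement_Cat[OF best[OF c that] best[OF c that]] y[OF c] that by auto
    then have "best_agreement (Alt (Cat (r c 0) (r c 0)) (Cat (r c 1) (r c 1))) (y c 0 @ y c 1)
        (max (4 ^ k * v c 0 + 4 ^ k * v c 0) (4 ^ k * v c 1 + 4 ^ k * v c 1))"
      by (intro best_agreement_Alt) auto
    moreover have "max (4 ^ k * p + 4 ^ k * p) (4 ^ k * q + 4 ^ k * q) = 2 * 4 ^ k * max p q"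
      for p q :: real
      by (auto simp: max_def)
    ultimately show ?thesis by simp
  qed
  have "best_agreement (tensor_regex (Suc k) a) (tensor_word (2 * Suc k) b)
      (2 * 4 ^ k * max (v 0 0) (v 0 1) + 2 * 4 ^ k * max (v 1 0) (v 1 1))"
    using best_agreement_Cat[OF half[of 0] half[of 1]]
    by (simp add: tensor_word_Suc r_def y_def)
  also have "2 * 4 ^ k * max (v 0 0) (v 0 1) + 2 * 4 ^ k * max (v 1 0) (v 1 1) =
      4 ^ Suc k * avg_level (2 * Suc k) (\<lambda>i. real (a i * b i))"
    by (simp add: v_def algebra_simps)
  finally show ?case .
qed

section \<open>Correctness of the machine\<close>

abbreviation codes :: "token list \<Rightarrow> nat list" where
  "codes \<equiv> map token_code"

lemma zero_notin_codes: "0 \<notin> set (codes w)"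
  using token_code_range by (metis (no_types, lifting) image_iff less_irrefl list.set_map)

text \<open>\<open>index_list\<close> recurses on the first coordinate, whereas a pass groups four
  neighbours, which differ in the last two.\<close>

lemma index_list_SucSuc:
  "index_list (Suc (Suc n)) =
    concat (map (\<lambda>i. [i @ [0, 0], i @ [0, 1], i @ [1, 0], i @ [1, 1]]) (index_list n))"
proof (induction n)
  case (Suc n)
  have "index_list (Suc (Suc (Suc n))) =
      map ((#) 0) (index_list (Suc (Suc n))) @ map ((#) 1) (index_list (Suc (Suc n)))"
    by (rule index_list.simps)
  also have "\<dots> = concat (map (\<lambda>i. [i @ [0, 0], i @ [0, 1], i @ [1, 0], i @ [1, 1]])
      (index_list (Suc n)))"
    unfolding Suc by (simp add: map_concat o_def)
  finally show ?case .
qed simp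

lemma merge_concat:
  "merge (concat (map (\<lambda>i. [f i, g i, h i, e i]) is)) = map (\<lambda>i. merge4 (f i) (g i) (h i) (e i)) is"
  by (induction "is") auto

text \<open>Invariant of the passes: an item is the level-\<open>j\<close> expression of the
  subtensor that fixes the leading coordinates to \<open>i\<close>. Each pass trades two coordinates
  of \<open>i\<close> for one level.\<close>

lemma merge_tensor:
  "(merge ^^ k) (map (\<lambda>i. codes (regex_text (tensor_regex j (\<lambda>l. a (i @ l))))) (index_list (2 * k))) =
    [codes (regex_text (tensor_regex (j + k) a))]"
proof (induction k arbitrary: j)
  case (Suc k)
  have "merge (map (\<lambda>i. codes (regex_text (tensor_regex j (\<lambda>l. a (i @ l))))) (index_list (2 * Suc k))) =
      map (\<lambda>i. codes (regex_text (tensor_regex (Suc j) (\<lambda>l. a (i @ l))))) (index_list (2 * k))"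
    by (simp add: index_list_SucSuc map_concat o_def merge_concat del: index_list.simps(2))
      (simp add: Let_def merge4_def)
  then show ?case
    using Suc[of "Suc j"] by (simp add: funpow_Suc_right del: funpow.simps)
qed simp

section \<open>Complete runs and total time\<close>

lemma item_run:
  "triple (conf 0 (codes (tensor_text (2 * k) a @ [ItemEnd]) @ inp) out ([], []) ([], []))
    (15 * 64 ^ k)
    (conf 0 inp (rev (codes (regex_text (tensor_regex k a) @ [ItemEnd])) @ out) ([], []) ([], []))"
proof -
  let ?cs = "codes (tensor_text (2 * k) a)"
  let ?xs = "map (\<lambda>c. [leaf_code c]) ?cs"
  let ?x = "codes (regex_text (tensor_regex k a))"
  have "?xs = map (\<lambda>i. codes (regex_text (tensor_regex 0 (\<lambda>l. a (i @ l))))) (index_list (2 * k))"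
    by (auto simp: tensor_text_def leaf_code_def split: if_splits)
  then have merged: "(merge ^^ k) ?xs = [?x]"
    using merge_tensor[of k 0 a] by simp
  have cs: "set ?cs \<subseteq> {1, 2}"
    by (auto simp: tensor_text_def split: if_splits)
  have 1: "triple (conf 0 (?cs @ 9 # inp) out ([], []) ([], [])) (2 * length ?cs + 1)
      (conf 2 inp out ([], []) (rewound (rev (items ?xs)) []))"
    using load_run[OF cs, of inp out "[]"] by simp
  have 2: "triple (conf 2 inp out ([], []) (rewound (rev (items ?xs)) [])) (merge_time k 1)
      (conf 5 inp out ([], ?x @ [9]) ([], []))"
  proof -
    have "length ?xs = 4 ^ k" "\<forall>x \<in> set ?xs. clean x \<and> length x \<le> 1"
      by (auto simp: tensor_text_def clean_def leaf_code_def power_mult)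
    from merge_run[OF this, of inp out] show ?thesis
      unfolding merged by simp
  qed
  have "0 \<notin> set (?x @ [9])"
    using zero_notin_codes by auto
  then have 3: "triple (conf 5 inp out ([], ?x @ [9]) ([], [])) (length (?x @ [9]) + 1)
      (conf 0 inp (rev (?x @ [9]) @ out) ([], []) ([], []))"
    by (rule emit_run)
  \<comment> \<open>In units of \<open>64 ^ k\<close>, loading costs at most 3, merging 8 and
    emitting 3. The factor \<open>3 + 4 * k\<close> is absorbed by a second
    \<open>8 ^ k\<close>.\<close>
  have "2 * length ?cs + 1 + (merge_time k 1 + (length (?x @ [9]) + 1)) \<le> 15 * 64 ^ k"
  proof -
    have p: "(4 :: nat) ^ k \<le> 64 ^ k" "(8 :: nat) ^ k \<le> 64 ^ k" "(1 :: nat) \<le> 64 ^ k"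
      by (auto intro: power_mono)
    have "k < 2 ^ k"
      by (rule less_exp)
    also have "(2 :: nat) ^ k \<le> 8 ^ k"
      by (rule power_mono) auto
    finally have "3 + 4 * k \<le> 4 * 8 ^ k"
      by simp
    then have "(3 + 4 * k) * 8 ^ k \<le> 4 * 8 ^ k * 8 ^ k"
      by (rule mult_right_mono) simp
    also have "\<dots> = 4 * 64 ^ k"
      by (simp add: power_mult_distrib[symmetric])
    finally have "merge_time k 1 \<le> 8 * 64 ^ k"
      using merge_time_le[of k 1] by simp
    moreover have "length ?cs = 4 ^ k"
      by (simp add: tensor_text_def power_mult)
    ultimately show ?thesis
      using tensor_regex_length_le[of k] p by (simp add: length_tensor_regex)
  qed
  from triple_mono[OF triple_trans[OF 1 triple_trans[OF 2 3]] this] show ?thesis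
    by simp
qed

lemma items_run:
  "triple (conf 0 (codes (items_text (map (tensor_text (2 * k)) as)) @ inp) out ([], []) ([], []))
    (length as * (15 * 64 ^ k))
    (conf 0 inp (rev (codes (items_text (map regex_text (map (tensor_regex k) as)))) @ out)
      ([], []) ([], []))"
proof (induction as arbitrary: out)
  case Nil
  show ?case by (simp add: items_text_def triple_refl)
next
  case (Cons a as)
  show ?case
    using triple_trans[OF item_run Cons.IH] by (simp add: items_text_def)
qed

lemma length_items_text:
  "(\<And>w. w \<in> set ws \<Longrightarrow> length w = n) \<Longrightarrow> length (items_text ws) = length ws * (n + 1)"
  by (induction ws) (auto simp: items_text_def)

lemma machine_run:
  assumes "length bs = length as" "1 \<le> length as"
  shows "triple (conf 0 (codes (input_text (2 * k) as bs)) [] ([], []) ([], []))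
    (19 * length as * 64 ^ k)
    (conf 22 [] (rev (codes (output_text (map (tensor_regex k) as) (map (tensor_word (2 * k)) bs))))
      ([], []) ([], []))"
proof -
  let ?N = "length as"
  let ?b = "codes (items_text (map (tensor_text (2 * k)) bs))"
  let ?a = "codes (items_text (map regex_text (map (tensor_regex k) as)))"
  have 1: "triple (conf 0 (10 # ?b) out ([], []) ([], [])) 1 (conf 6 ?b (10 # out) ([], []) ([], []))"
    for out
    by (rule conf_step) (auto simp: merge_trans_def Let_def)
  note run = triple_trans[OF items_run triple_trans[OF 1 copy_run[OF zero_notin_codes]]]
  \<comment> \<open>Copying the strings costs at most 2 units of \<open>?N * 64 ^ k\<close>; as
    \<open>?N\<close> is positive, the two extra steps fit into the other 2.\<close>
  have "?N * (15 * 64 ^ k) + (1 + (length ?b + 1)) \<le> 19 * ?N * 64 ^ k"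
  proof -
    have "length ?b = ?N * (4 ^ k + 1)"
      using assms(1) by (subst length_map, subst length_items_text[where n = "4 ^ k"])
        (auto simp: tensor_text_def power_mult)
    also have "\<dots> \<le> ?N * (2 * 64 ^ k)"
    proof -
      have "(4 :: nat) ^ k \<le> 64 ^ k" "(1 :: nat) \<le> 64 ^ k"
        by (auto intro: power_mono)
      then show ?thesis by (intro mult_left_mono) linarith+
    qed
    finally have "length ?b \<le> ?N * (2 * 64 ^ k)" .
    moreover have "1 * 1 \<le> ?N * 64 ^ k"
      using assms(2) by (intro mult_mono) auto
    moreover have "?N * (15 * 64 ^ k) = 15 * (?N * 64 ^ k)" "?N * (2 * 64 ^ k) = 2 * (?N * 64 ^ k)"
      "19 * ?N * 64 ^ k = 19 * (?N * 64 ^ k)"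
      by (simp_all only: mult.left_commute mult.assoc)
    ultimately show ?thesis by linarith
  qed
  from triple_mono[OF run this, of "[]"] show ?thesis
    by (simp add: input_text_def output_text_def o_def flip: tensor_text_word)
qed

lemma init_config_conf:
  "init_config merge_machine w \<in> conf 0 (codes w) [] ([], []) ([], [])"
proof -
  have blank: "(cells [], 0) = tape_of 0 ([], [])"
    by (auto simp: tape_of.simps cells_def)
  have "(cells w, 0) = tape_of 0 ([], codes w)"
    by (auto simp: tape_of.simps cells_def nth_default_def fun_eq_iff)
  then have "init_config merge_machine w = (0, [tape_of 0 ([], codes w),
      tape_of (int (length ([] :: nat list))) ([], []), tape_of 0 ([], []), tape_of 0 ([], [])])"
    by (simp add: init_config_def blank numeral_3_eq_3)
  then show ?thesis
    unfolding conf_def by blast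
qed

text \<open>With the head at \<open>length w\<close> and the reversed output to its left, the output
  starts exactly at cell 0.\<close>

lemma fst_tape_of_output: "fst (tape_of (int (length w)) (rev (codes w), [])) = cells w"
proof
  fix j
  show "fst (tape_of (int (length w)) (rev (codes w), [])) j = cells w j"
  proof (cases "0 \<le> j \<and> j < int (length w)")
    case True
    then have "nat (int (length w) - 1 - j) = length w - Suc (nat j)" "nat j < length w"
      "length w - Suc (nat j) < length w"
      by auto
    then show ?thesis
      using True by (simp add: tape_of.simps cells_def nth_default_def rev_nth)
  next
    case False
    then show ?thesis
      by (auto simp: tape_of.simps cells_def nth_default_def)
  qed
qed

lemma computes_within_of_triple:
  assumes "triple (conf 0 (codes inp) [] ([], []) ([], [])) T (conf 22 r (rev (codes out)) z2 z3)"
  shows "computes_within merge_machine inp out T"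
proof -
  obtain n where n: "n \<le> T"
    "(step merge_machine ^^ n) (init_config merge_machine inp) \<in> conf 22 r (rev (codes out)) z2 z3"
    using assms init_config_conf unfolding triple_def by blast
  then show ?thesis
    unfolding computes_within_def
    by (intro exI[of _ n] conjI) (auto simp: conf_def fst_tape_of_output)
qed

theorem theorem7p1:
  "\<exists>M C k C' k'. wf_machine M \<and>
    (\<forall>t N A B as bs.
       even t \<and> 1 \<le> N \<and>
       A \<subseteq> tensors t \<and> card A = N \<and>
       B \<subseteq> tensors t \<and> card B = N \<and> (\<forall>b \<in> B. max_invariant t b) \<and>
       distinct as \<and> set as = A \<and> distinct bs \<and> set bs = B \<longrightarrow>
       (\<exists>f g A' B'.
          computes_within M (input_text t as bs) (output_text (map f as) (map g bs))
            (C * N * (2 ^ t) ^ k) \<and>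
          bij_betw f A A' \<and> card A' = N \<and> inj_on regex_text A' \<and>
          (\<forall>r \<in> A'. regex_length r \<le> C' * (2 ^ t) ^ k') \<and>
          bij_betw g B B' \<and> card B' = N \<and> (\<forall>w \<in> B'. length w = 2 ^ t) \<and>
          (\<forall>a \<in> A. \<forall>b \<in> B.
             (\<exists>x \<in> lang (f a). length x = length (g b)) \<and>
             MaxSim (f a) (g b) = trop_sim t a b)))"
proof -
  have main: "\<exists>f g A' B'.
          computes_within merge_machine (input_text t as bs) (output_text (map f as) (map g bs))
            (19 * N * (2 ^ t) ^ 3) \<and>
          bij_betw f A A' \<and> card A' = N \<and> inj_on regex_text A' \<and>
          (\<forall>r \<in> A'. regex_length r \<le> 2 * (2 ^ t) ^ 2) \<and>
          bij_betw g B B' \<and> card B' = N \<and> (\<forall>w \<in> B'. length w = 2 ^ t) \<and>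
          (\<forall>a \<in> A. \<forall>b \<in> B.
             (\<exists>x \<in> lang (f a). length x = length (g b)) \<and>
             MaxSim (f a) (g b) = trop_sim t a b)"
    if "even t" and N: "1 \<le> N" and A: "A \<subseteq> tensors t" "card A = N"
      and B: "B \<subseteq> tensors t" "card B = N" "\<forall>b \<in> B. max_invariant t b"
      and as: "distinct as" "set as = A" and bs: "distinct bs" "set bs = B" for t N A B as bs
  proof -
    obtain k where t: "t = 2 * k"
      using \<open>even t\<close> by blast
    have len: "length as = N" "length bs = N"
      using A(2) B(2) as bs distinct_card by metis+
    \<comment> \<open>The time bound \<open>64 ^ k\<close> is the cube of \<open>2 ^ t\<close>. The
      length bound \<open>2 * 8 ^ k\<close> has exponent 3/2 in \<open>2 ^ t\<close>, so the integer
      exponent 2 suffices.\<close>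
    have "(2 ^ t) ^ 3 = (2 :: nat) ^ (6 * k)" "(2 ^ t) ^ 2 = (2 :: nat) ^ (4 * k)"
      by (simp_all add: t flip: power_mult)
    then have pow: "(2 ^ t) ^ 3 = (64 :: nat) ^ k" "(2 ^ t) ^ 2 = (16 :: nat) ^ k"
      by (simp_all add: power_mult)
    have "computes_within merge_machine (input_text t as bs)
        (output_text (map (tensor_regex k) as) (map (tensor_word t) bs)) (19 * N * (2 ^ t) ^ 3)"
      using computes_within_of_triple[OF machine_run[of bs as k]] len N unfolding pow
      by (simp add: t)
    moreover have inj: "inj_on (\<lambda>a. regex_text (tensor_regex k a)) A"
      using inj_tensor_regex_text A(1) inj_on_subset unfolding t by blast
    have injr: "inj_on (tensor_regex k) A"
      using inj by (auto simp: inj_on_def)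
    then have "bij_betw (tensor_regex k) A (tensor_regex k ` A)" "card (tensor_regex k ` A) = N"
      using A(2) by (auto simp: bij_betw_def card_image)
    moreover have "inj_on regex_text (tensor_regex k ` A)"
      using inj by (auto simp: inj_on_def)
    moreover have "\<forall>r \<in> tensor_regex k ` A. regex_length r \<le> 2 * (2 ^ t) ^ 2"
    proof -
      have "(8 :: nat) ^ k \<le> 16 ^ k"
        by (rule power_mono) auto
      then show ?thesis
        unfolding pow regex_length_def using tensor_regex_length_le[of k]
        by (auto simp: length_tensor_regex)
    qed
    moreover have "inj_on (tensor_word t) B"
      using inj_tensor_word B(1) inj_on_subset by blast
    then have "bij_betw (tensor_word t) B (tensor_word t ` B)" "card (tensor_word t ` B) = N"
      using B(2) by (auto simp: bij_betw_def card_image)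
    moreover have word: "length (tensor_word t b) = 2 ^ t" for b
      by (simp add: tensor_word_def)
    moreover have "(\<exists>x \<in> lang (tensor_regex k a). length x = length (tensor_word t b)) \<and>
        MaxSim (tensor_regex k a) (tensor_word t b) = trop_sim t a b" if "a \<in> A" "b \<in> B" for a b
    proof -
      have "a \<in> tensors t" "b \<in> tensors t"
        using that A(1) B(1) by auto
      then have "best_agreement (tensor_regex k a) (tensor_word (2 * k) b)
          (4 ^ k * avg_level (2 * k) (\<lambda>i. real (a i * b i)))"
        using that B(3) unfolding t tensors_def by (intro best_agreement_tensor) auto
      from MaxSim_best_agreement[OF this] word[of b] show ?thesis
        by (simp add: t trop_sim_def power_mult)
    qed
    ultimately show ?thesis
      by (intro exI[of _ "tensor_regex k"] exI[of _ "tensor_word t"]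
          exI[of _ "tensor_regex k ` A"] exI[of _ "tensor_word t ` B"]) auto
  qed
  show ?thesis
  proof (rule exI[of _ merge_machine], rule exI[of _ 19], rule exI[of _ 3], rule exI[of _ 2],
      rule exI[of _ 2], intro conjI wf_merge_machine allI impI, elim conjE)
  qed (rule main)
qed

end
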